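(* Let $D$ be a weighted oriented graph such that each edge of $D$ lies in some induced odd cycle of $D$. Then $V(D)$ is a strong vertex cover of $D$ if and only if $I(D)^{(s)}=I(D)^s$ for all $s\ge 2$.
   Context: Let $k$ be a field. A weighted oriented graph $D=(V(D),E(D),w)$ has a finite vertex set $V(D)$, a set $E(D)$ of ordered pairs of distinct vertices ($(x,y)\in E(D)$ is a directed edge from $x$ to $y$), each edge $\{x,y\}$ of the underlying simple graph $G$ carrying exactly one orientation, and a weight function $w:V(D)\to\mathbb N=\{1,2,\dots\}$. A vertex is a source if it has only outgoing edges; convention: sources have weight $1$. The edge ideal of $D$ is $I(D)=(x\,y^{w(y)} : (x,y)\in E(D))$ in the polynomial ring $R$ over $k$ whose variables are the vertices of $D$. For $s\ge1$ the $s$-th symbolic power of an ideal $I$ is $I^{(s)}=\bigcap_{P\in\operatorname{Ass}(I)}(I^sR_P\cap R)$, where $\operatorname{Ass}(I)$ is the set of associated primes of $R/I$. An induced odd cycle of $D$ is an induced subgraph of $D$ whose underlying graph is a cycle of odd length. Write $N_D^+(x)=\{y:(x,y)\in E(D)\}$, $N_D^-(x)=\{y:(y,x)\in E(D)\}$, and $V^+(D)=\{x: w(x)\ne1\}$. A vertex cover of $D$ is a set $C\subseteq V(D)$ meeting every edge; $C^c=V(D)\setminus C$. For a vertex cover $C$ put $L_1^D(C)=\{x\in C: N_D^+(x)\cap C^c\ne\emptyset\}$, $L_2^D(C)=\{x\in C: x\notin L_1^D(C),\ N_D^-(x)\cap C^c\neq\emptyset\}$, $L_3^D(C)=C\setminus(L_1^D(C)\cup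 L_2^D(C))$. A vertex cover $C$ is strong if for each $x\in L_3^D(C)$ there is $(y,x)\in E(D)$ with $y\in (L_2^D(C)\cup L_3^D(C))\cap V^+(D)$.
   Formalization: The formal theorem assumes that D has at least one vertex and no isolated vertices; with isolated vertices the claim fails, e.g. for one vertex and no edges I(D)=0 has equal powers but V(D) is not strong. *)

theory Defs
  imports Complex_Main "HOL-Library.Poly_Mapping"
begin

section \<open>Ideals of commutative rings\<close>

text \<open>A commutative ring is a module over itself: its ideals are the submodules and
  \<open>ideal.span S\<close> is the ideal generated by \<open>S\<close>.\<close>

global_interpretation ideal: module "times :: 'a::comm_ring_1 \<Rightarrow> 'a \<Rightarrow> 'a"
  by standard (simp_all add: algebra_simps)

definition ideal_mult :: "'a::comm_ring_1 set \<Rightarrow> 'a set \<Rightarrow> 'a set" where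
  "ideal_mult I J = ideal.span {a * b | a b. a \<in> I \<and> b \<in> J}"

primrec ideal_power :: "'a::comm_ring_1 set \<Rightarrow> nat \<Rightarrow> 'a set" where
  "ideal_power I 0 = UNIV"
| "ideal_power I (Suc n) = ideal_mult I (ideal_power I n)"

definition prime_ideal :: "'a::comm_ring_1 set \<Rightarrow> bool" where
  "prime_ideal P \<longleftrightarrow> ideal.subspace P \<and> P \<noteq> UNIV \<and>
     (\<forall>a b. a * b \<in> P \<longrightarrow> a \<in> P \<or> b \<in> P)"

text \<open>The set \<open>{r. r * f \<in> I}\<close> is the annihilator of the residue class of \<open>f\<close> in \<open>R/I\<close>.\<close>

definition associated_primes :: "'a::comm_ring_1 set \<Rightarrow> 'a set set" where
  "associated_primes I = {P. prime_ideal P \<and> (\<exists>f. P = {r. r * f \<in> I})}"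

text \<open>\<open>loc_frac P a s\<close> is the fraction \<open>a/s\<close> as an element of the localization \<open>R\<^sub>P\<close>, that is, the
  equivalence class of \<open>(a, s)\<close>; it is meaningful for \<open>s \<notin> P\<close>. Accordingly \<open>loc_extension P I\<close> is
  the ideal \<open>I R\<^sub>P\<close>, and \<open>loc_contraction P J\<close> is the preimage of \<open>J\<close> under the canonical map
  from \<open>R\<close> to \<open>R\<^sub>P\<close>.\<close>

definition loc_frac :: "'a::comm_ring_1 set \<Rightarrow> 'a \<Rightarrow> 'a \<Rightarrow> ('a \<times> 'a) set" where
  "loc_frac P a s = {(b, t). t \<notin> P \<and> (\<exists>u. u \<notin> P \<and> u * (a * t - b * s) = 0)}"

definition loc_extension :: "'a::comm_ring_1 set \<Rightarrow> 'a set \<Rightarrow> ('a \<times> 'a) set set" where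
  "loc_extension P I = {loc_frac P a s | a s. a \<in> I \<and> s \<notin> P}"

definition loc_contraction :: "'a::comm_ring_1 set \<Rightarrow> ('a \<times> 'a) set set \<Rightarrow> 'a set" where
  "loc_contraction P J = {r. loc_frac P r 1 \<in> J}"

definition symbolic_power :: "'a::comm_ring_1 set \<Rightarrow> nat \<Rightarrow> 'a set" where
  "symbolic_power I s =
     (\<Inter>P \<in> associated_primes I. loc_contraction P (loc_extension P (ideal_power I s)))"

section \<open>Weighted oriented graphs\<close>

text \<open>The vertex set of a graph is the whole finite type \<open>'v\<close>.\<close>

definition out_nbrs :: "('v \<times> 'v) set \<Rightarrow> 'v \<Rightarrow> 'v set" where
  "out_nbrs E x = {y. (x, y) \<in> E}"

definition in_nbrs :: "('v \<times> 'v) set \<Rightarrow> 'v \<Rightarrow> 'v set" where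
  "in_nbrs E x = {y. (y, x) \<in> E}"

definition is_source :: "('v \<times> 'v) set \<Rightarrow> 'v \<Rightarrow> bool" where
  "is_source E x \<longleftrightarrow> in_nbrs E x = {}"

definition weighted_oriented_graph :: "('v::finite \<times> 'v) set \<Rightarrow> ('v \<Rightarrow> nat) \<Rightarrow> bool" where
  "weighted_oriented_graph E w \<longleftrightarrow>
     (\<forall>x. (x, x) \<notin> E) \<and>
     (\<forall>x y. (x, y) \<in> E \<longrightarrow> (y, x) \<notin> E) \<and>
     (\<forall>x. w x \<ge> 1) \<and>
     (\<forall>x. is_source E x \<longrightarrow> w x = 1)"

definition underlying_edges :: "('v \<times> 'v) set \<Rightarrow> 'v set set" where
  "underlying_edges E = {{x, y} | x y. (x, y) \<in> E}"

definition induced_edges :: "('v \<times> 'v) set \<Rightarrow> 'v set \<Rightarrow> ('v \<times> 'v) set" where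
  "induced_edges E W = E \<inter> (W \<times> W)"

definition is_cycle_graph :: "'v set \<Rightarrow> 'v set set \<Rightarrow> bool" where
  "is_cycle_graph W G \<longleftrightarrow>
     (\<exists>c. length c \<ge> 3 \<and> distinct c \<and> set c = W \<and>
          G = {{c ! i, c ! (Suc i mod length c)} | i. i < length c})"

definition induced_odd_cycle :: "('v \<times> 'v) set \<Rightarrow> 'v set \<Rightarrow> bool" where
  "induced_odd_cycle E W \<longleftrightarrow>
     is_cycle_graph W (underlying_edges (induced_edges E W)) \<and> odd (card W)"

definition heavy_vertices :: "('v \<Rightarrow> nat) \<Rightarrow> 'v set" where
  "heavy_vertices w = {x. w x \<noteq> 1}"

definition vertex_cover :: "('v \<times> 'v) set \<Rightarrow> 'v set \<Rightarrow> bool" where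
  "vertex_cover E C \<longleftrightarrow> (\<forall>(x, y) \<in> E. x \<in> C \<or> y \<in> C)"

definition L1 :: "('v \<times> 'v) set \<Rightarrow> 'v set \<Rightarrow> 'v set" where
  "L1 E C = {x \<in> C. out_nbrs E x \<inter> - C \<noteq> {}}"

definition L2 :: "('v \<times> 'v) set \<Rightarrow> 'v set \<Rightarrow> 'v set" where
  "L2 E C = {x \<in> C. x \<notin> L1 E C \<and> in_nbrs E x \<inter> - C \<noteq> {}}"

definition L3 :: "('v \<times> 'v) set \<Rightarrow> 'v set \<Rightarrow> 'v set" where
  "L3 E C = C - (L1 E C \<union> L2 E C)"

definition strong_vertex_cover :: "('v \<times> 'v) set \<Rightarrow> ('v \<Rightarrow> nat) \<Rightarrow> 'v set \<Rightarrow> bool" where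
  "strong_vertex_cover E w C \<longleftrightarrow>
     vertex_cover E C \<and>
     (\<forall>x \<in> L3 E C. \<exists>y. (y, x) \<in> E \<and> y \<in> (L2 E C \<union> L3 E C) \<inter> heavy_vertices w)"

section \<open>Edge ideals\<close>

text \<open>Polynomials over \<open>'k\<close> in the variables \<open>'v\<close>, as finitely supported functions from exponent
  vectors to coefficients; multiplication is convolution.\<close>

type_synonym ('v, 'k) mpoly = "('v \<Rightarrow>\<^sub>0 nat) \<Rightarrow>\<^sub>0 'k"

definition Var :: "'v \<Rightarrow> ('v, 'k::field) mpoly" where
  "Var x = Poly_Mapping.single (Poly_Mapping.single x 1) 1"

definition edge_ideal :: "('v \<times> 'v) set \<Rightarrow> ('v \<Rightarrow> nat) \<Rightarrow> ('v, 'k::field) mpoly set" where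
  "edge_ideal E w = ideal.span {Var x * Var y ^ w y | x y. (x, y) \<in> E}"

end

theory Submission imports Defs begin

text \<open>\<open>V\<close> is a strong vertex cover iff every vertex has an in-neighbour of weight at least \<open>2\<close>. In
  that case the irrelevant ideal is associated to \<open>I = I(D)\<close>, and localizing there does not change a
  monomial ideal, so \<open>I\<^sup>(\<^sup>s\<^sup>) = I\<^sup>s\<close>.

  Otherwise pick \<open>x\<close> all of whose in-neighbours have weight \<open>1\<close>, and an induced odd cycle \<open>W\<close> with
  \<open>2n + 1\<close> vertices through \<open>x\<close> and, unless \<open>x\<close> is a source, through an in-neighbour of \<open>x\<close>. Let \<open>f\<close>
  be the product over \<open>v \<in> W\<close> of \<open>v ^ a v\<close>, where \<open>a v = 1\<close> if \<open>v\<close> is a source within \<open>W\<close> and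
  \<open>a v = w v\<close> otherwise. Two edges whose product divides \<open>f\<close> are disjoint, so \<open>f\<close> is not divisible by a
  product of \<open>n + 1\<close> edges. Yet \<open>f\<close> lies in \<open>I\<^sup>n\<^sup>+\<^sup>1\<close> locally at each associated prime \<open>P\<close>: if \<open>P\<close>
  misses some \<open>v \<in> W\<close>, the factors of the two neighbours of \<open>v\<close> on the cycle are locally in \<open>I\<close> and the
  remaining vertices form \<open>n - 1\<close> edges; if \<open>P\<close> contains \<open>W\<close>, the factor of \<open>x\<close> is locally in \<open>I\<close> and the
  remaining vertices form \<open>n\<close> edges.\<close>

text \<open>For the ring as a module over itself this rule reads \<open>a * (b * x) = (a * b) * x\<close> and loops with
  associativity.\<close>

declare ideal.scale_scale [simp del]

section \<open>Monomial ideals\<close>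

abbreviation "lookup \<equiv> Poly_Mapping.lookup"
abbreviation "keys \<equiv> Poly_Mapping.keys"

abbreviation mon_dvd :: "('v \<Rightarrow>\<^sub>0 nat) \<Rightarrow> ('v \<Rightarrow>\<^sub>0 nat) \<Rightarrow> bool" where
  "mon_dvd g m \<equiv> \<forall>v. lookup g v \<le> lookup m v"

abbreviation monom :: "('v \<Rightarrow>\<^sub>0 nat) \<Rightarrow> ('v, 'k::field) mpoly" where
  "monom m \<equiv> Poly_Mapping.single m 1"

text \<open>Given by supports instead of as a span, so that membership is a divisibility test on
  exponents; \<open>span_monom\<close> identifies it with the generated ideal.\<close>

definition monomial_ideal :: "('v \<Rightarrow>\<^sub>0 nat) set \<Rightarrow> ('v, 'k::field) mpoly set" where
  "monomial_ideal S = {p. \<forall>m\<in>keys p. \<exists>g\<in>S. mon_dvd g m}"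

text \<open>When the supports allow only one way of writing \<open>a + b\<close>, the convolution
  sum has a single term. This serves monomial factors, constant coefficients and terms of least
  degree.\<close>

lemma lookup_mult_unique_factorization:
  fixes p q :: "'a::cancel_comm_monoid_add \<Rightarrow>\<^sub>0 'b::semiring_0"
  assumes "\<And>l m. l \<in> keys p \<Longrightarrow> m \<in> keys q \<Longrightarrow> l + m = a + b \<Longrightarrow> l = a"
  shows "lookup (p * q) (a + b) = lookup p a * lookup q b"
proof -
  have "lookup p l * (\<Sum>m. lookup q m when a + b = l + m)
      = (lookup p a * lookup q b when l = a)" for l
  proof (cases "l = a")
    case False
    have "(lookup q m when a + b = l + m) = 0" if "l \<in> keys p" for m
      using assms[OF that, of m] False by (cases "m \<in> keys q") (auto simp: when_def in_keys_iff)
    then show ?thesis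
      using False by (cases "l \<in> keys p") (simp_all add: in_keys_iff)
  qed simp
  then show ?thesis
    by (simp add: lookup_mult)
qed

lemma lookup_monom_mult:
  "lookup (monom a * p) (a + b) = lookup p b" for p :: "('v, 'k::field) mpoly"
  by (subst lookup_mult_unique_factorization) auto

lemma lookup_mult_0:
  "lookup (p * q) 0 = lookup p 0 * lookup q 0" for p q :: "('v, 'k::field) mpoly"
proof -
  have "lookup (p * q) (0 + 0) = lookup p 0 * lookup q 0"
    by (rule lookup_mult_unique_factorization)
      (metis add_is_0 lookup_add lookup_zero poly_mapping_eqI add_0_left)
  then show ?thesis by simp
qed

lemma poly_mapping_eq_sum_single: "p = (\<Sum>m\<in>keys p. Poly_Mapping.single m (lookup p m))"
  by (rule poly_mapping_eqI) (auto simp: lookup_sum lookup_single when_def in_keys_iff)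

lemma mon_dvd_imp_add: "mon_dvd g m \<Longrightarrow> m = (m - g) + g"
  by (rule poly_mapping_eqI) (simp add: lookup_add lookup_minus)

lemma monom_mem_monomial_ideal_iff:
  "(monom m :: ('v, 'k::field) mpoly) \<in> monomial_ideal S \<longleftrightarrow> (\<exists>g\<in>S. mon_dvd g m)"
  by (simp add: monomial_ideal_def)

lemma subspace_monomial_ideal:
  "ideal.subspace (monomial_ideal S :: ('v, 'k::field) mpoly set)"
proof (rule ideal.subspaceI)
  fix p q :: "('v, 'k) mpoly"
  assume q: "q \<in> monomial_ideal S"
  show "p * q \<in> monomial_ideal S"
    unfolding monomial_ideal_def
  proof (intro CollectI ballI)
    fix m assume "m \<in> keys (p * q)"
    then obtain a b where m: "m = a + b" "b \<in> keys q"
      using keys_mult[of p q] by blast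
    then obtain g where "g \<in> S" "mon_dvd g b"
      using q by (auto simp: monomial_ideal_def)
    then show "\<exists>g\<in>S. mon_dvd g m"
      by (intro bexI[of _ g]) (auto simp: m lookup_add trans_le_add2)
  qed
next
  fix p q :: "('v, 'k) mpoly"
  assume "p \<in> monomial_ideal S" "q \<in> monomial_ideal S"
  then show "p + q \<in> monomial_ideal S"
    using keys_add[of p q] by (auto simp: monomial_ideal_def)
qed (simp add: monomial_ideal_def)

lemma span_monom:
  "ideal.span (monom ` S) = (monomial_ideal S :: ('v, 'k::field) mpoly set)"
proof
  show "ideal.span (monom ` S) \<subseteq> (monomial_ideal S :: ('v, 'k) mpoly set)"
    by (intro ideal.span_minimal subspace_monomial_ideal)
      (auto simp: monom_mem_monomial_ideal_iff)
  show "monomial_ideal S \<subseteq> (ideal.span (monom ` S) :: ('v, 'k) mpoly set)"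
  proof
    fix p :: "('v, 'k) mpoly"
    assume p: "p \<in> monomial_ideal S"
    have "Poly_Mapping.single m (lookup p m) \<in> ideal.span (monom ` S)" if "m \<in> keys p" for m
    proof -
      obtain g where g: "g \<in> S" "mon_dvd g m"
        using p \<open>m \<in> keys p\<close> by (auto simp: monomial_ideal_def)
      have "Poly_Mapping.single (m - g) (lookup p m) * monom g \<in> ideal.span (monom ` S)"
        using g by (intro ideal.span_scale ideal.span_base) auto
      then show ?thesis
        using mon_dvd_imp_add[OF g(2)] by (simp add: mult_single)
    qed
    then show "p \<in> ideal.span (monom ` S)"
      by (subst poly_mapping_eq_sum_single) (rule ideal.span_sum)
  qed
qed

lemma ideal_mult_monomial_ideal:
  "ideal_mult (monomial_ideal S) (monomial_ideal T)
     = (monomial_ideal {a + b | a b. a \<in> S \<and> b \<in> T} :: ('v, 'k::field) mpoly set)"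
    (is "?L = monomial_ideal ?U")
proof
  show "?L \<subseteq> monomial_ideal ?U"
    unfolding ideal_mult_def
  proof (intro ideal.span_minimal subspace_monomial_ideal subsetI)
    fix r :: "('v, 'k) mpoly"
    assume "r \<in> {a * b | a b. a \<in> monomial_ideal S \<and> b \<in> monomial_ideal T}"
    then obtain p q where r: "r = p * q" and p: "p \<in> monomial_ideal S"
      and q: "q \<in> monomial_ideal T" by auto
    show "r \<in> monomial_ideal ?U"
      unfolding monomial_ideal_def
    proof (intro CollectI ballI)
      fix m assume "m \<in> keys r"
      then obtain a b where m: "m = a + b" and "a \<in> keys p" "b \<in> keys q"
        using keys_mult[of p q] r by blast
      then obtain g h where "g \<in> S" "mon_dvd g a" "h \<in> T" "mon_dvd h b"
        using p q by (fastforce simp: monomial_ideal_def)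
      then show "\<exists>g\<in>?U. mon_dvd g m"
        by (intro bexI[of _ "g + h"]) (auto simp: m lookup_add add_mono)
    qed
  qed
  have "(monom u :: ('v, 'k) mpoly) \<in> ?L" if u: "u \<in> ?U" for u
  proof -
    obtain a b where "u = a + b" "a \<in> S" "b \<in> T" using u by blast
    then have "(monom u :: ('v, 'k) mpoly) = monom a * monom b"
      "(monom a :: ('v, 'k) mpoly) \<in> monomial_ideal S"
      "(monom b :: ('v, 'k) mpoly) \<in> monomial_ideal T"
      by (auto simp: mult_single monom_mem_monomial_ideal_iff)
    then show ?thesis
      unfolding ideal_mult_def by (intro ideal.span_base) blast
  qed
  then show "monomial_ideal ?U \<subseteq> ?L"
    unfolding span_monom[symmetric]
    by (intro ideal.span_minimal) (auto simp: ideal_mult_def)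
qed

lemma Var_power: "(Var x :: ('v, 'k::field) mpoly) ^ n = monom (Poly_Mapping.single x n)"
  by (induction n) (simp_all add: Var_def mult_single flip: single_add)

section \<open>Powers of the edge ideal\<close>

definition edge_exp :: "('v \<Rightarrow> nat) \<Rightarrow> 'v \<times> 'v \<Rightarrow> 'v \<Rightarrow>\<^sub>0 nat" where
  "edge_exp w e = Poly_Mapping.single (fst e) 1 + Poly_Mapping.single (snd e) (w (snd e))"

text \<open>Lists of edges, since a generator of a power may use an edge repeatedly.\<close>

definition power_exps :: "('v \<times> 'v) set \<Rightarrow> ('v \<Rightarrow> nat) \<Rightarrow> nat \<Rightarrow> ('v \<Rightarrow>\<^sub>0 nat) set" where
  "power_exps E w s = {sum_list (map (edge_exp w) es) | es. length es = s \<and> set es \<subseteq> E}"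

lemma lookup_edge_exp:
  "lookup (edge_exp w (x, y)) v = (if v = x then 1 else 0) + (if v = y then w y else 0)"
  by (auto simp: edge_exp_def lookup_add lookup_single when_def)

lemma Var_mult_Var_power: "Var x * Var y ^ w y = monom (edge_exp w (x, y))"
  unfolding Var_power by (simp add: Var_def mult_single edge_exp_def)

lemma edge_ideal_eq: "edge_ideal E w = monomial_ideal (edge_exp w ` E)"
proof -
  have "{Var x * Var y ^ w y :: ('a, 'b) mpoly | x y. (x, y) \<in> E} = monom ` edge_exp w ` E"
    unfolding Var_mult_Var_power by force
  then show ?thesis
    by (simp add: edge_ideal_def span_monom)
qed

lemma power_exps_Suc:
  "power_exps E w (Suc s) = {a + b | a b. a \<in> edge_exp w ` E \<and> b \<in> power_exps E w s}"
  (is "?L = ?R")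
proof
  show "?L \<subseteq> ?R"
  proof
    fix m assume "m \<in> ?L"
    then obtain es where m: "m = sum_list (map (edge_exp w) es)" "length es = Suc s" "set es \<subseteq> E"
      by (auto simp: power_exps_def)
    then obtain e es' where "es = e # es'" by (cases es) auto
    with m show "m \<in> ?R" by (auto simp: power_exps_def)
  qed
  show "?R \<subseteq> ?L"
  proof
    fix m assume "m \<in> ?R"
    then obtain e es where "m = edge_exp w e + sum_list (map (edge_exp w) es)"
      "e \<in> E" "length es = s" "set es \<subseteq> E"
      by (auto simp: power_exps_def)
    then show "m \<in> ?L"
      by (auto simp: power_exps_def intro!: exI[of _ "e # es"])
  qed
qed

lemma ideal_power_edge_ideal:
  "ideal_power (edge_ideal E w) s = (monomial_ideal (power_exps E w s) :: ('v, 'k::field) mpoly set)"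
proof (induction s)
  case 0
  then show ?case by (auto simp: power_exps_def monomial_ideal_def)
next
  case (Suc s)
  then show ?case
    by (simp add: edge_ideal_eq ideal_mult_monomial_ideal power_exps_Suc)
qed

section \<open>Localization\<close>

lemma prime_ideal_one_notin: "prime_ideal P \<Longrightarrow> 1 \<notin> P"
  using ideal.subspace_scale[of P 1] unfolding prime_ideal_def by fastforce

lemma prime_ideal_mult_notin: "prime_ideal P \<Longrightarrow> a \<notin> P \<Longrightarrow> b \<notin> P \<Longrightarrow> a * b \<notin> P"
  unfolding prime_ideal_def by blast

lemma prime_ideal_power_notin: "prime_ideal P \<Longrightarrow> z \<notin> P \<Longrightarrow> z ^ n \<notin> P"
  by (induction n) (simp_all add: prime_ideal_one_notin prime_ideal_mult_notin)

text \<open>Fractions are sets of pairs, and \<open>(r, 1)\<close> lies in its own class; reading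
  this in the class of \<open>a/s\<close> yields the denominator \<open>u * s\<close>.\<close>

lemma loc_contraction_extensionD:
  assumes "prime_ideal P" and "ideal.subspace J"
    and "r \<in> loc_contraction P (loc_extension P J)"
  obtains u where "u \<notin> P" "u * r \<in> J"
proof -
  obtain a s where as: "loc_frac P r 1 = loc_frac P a s" "a \<in> J" "s \<notin> P"
    using assms(3) by (auto simp: loc_contraction_def loc_extension_def)
  have "(r, 1) \<in> loc_frac P r 1"
    using prime_ideal_one_notin[OF assms(1)] by (auto simp: loc_frac_def intro: exI[of _ 1])
  then obtain u where u: "u \<notin> P" "u * (a * 1 - r * s) = 0"
    unfolding as by (auto simp: loc_frac_def)
  then have "(u * s) * r = u * a" by (simp add: algebra_simps)
  moreover have "u * a \<in> J"
    using assms(2) as(2) by (rule ideal.subspace_scale)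
  moreover have "u * s \<notin> P"
    using assms(1) u(1) as(3) by (rule prime_ideal_mult_notin)
  ultimately show thesis using that by metis
qed

lemma loc_contraction_extensionI:
  assumes "prime_ideal P" and u: "u \<notin> P" and "u * r \<in> J"
  shows "r \<in> loc_contraction P (loc_extension P J)"
proof -
  have "loc_frac P r 1 = loc_frac P (u * r) u"
  proof -
    have "(\<exists>v. v \<notin> P \<and> v * (r * t - b * 1) = 0) \<longleftrightarrow> (\<exists>v. v \<notin> P \<and> v * (u * r * t - b * u) = 0)"
      (is "?A \<longleftrightarrow> ?B") for b t
    proof
      assume ?A
      then obtain v where v: "v \<notin> P" "v * (r * t - b * 1) = 0" by auto
      have "v * (u * r * t - b * u) = u * (v * (r * t - b * 1))" by (simp add: algebra_simps)
      with v show ?B by (metis mult_zero_right)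
    next
      assume ?B
      then obtain v where v: "v \<notin> P" "v * (u * r * t - b * u) = 0" by auto
      have "(v * u) * (r * t - b * 1) = v * (u * r * t - b * u)" by (simp add: algebra_simps)
      moreover have "v * u \<notin> P" using assms(1) v(1) u by (rule prime_ideal_mult_notin)
      ultimately show ?A using v(2) by metis
    qed
    then show ?thesis by (simp add: loc_frac_def)
  qed
  then show ?thesis
    using assms by (auto simp: loc_contraction_def loc_extension_def)
qed

lemma ideal_power_subset_symbolic_power: "ideal_power I s \<subseteq> symbolic_power I s"
proof -
  have "r \<in> loc_contraction P (loc_extension P (ideal_power I s))"
    if "P \<in> associated_primes I" "r \<in> ideal_power I s" for P r
  proof -
    have "prime_ideal P" using that(1) by (simp add: associated_primes_def)
    moreover from this have "1 \<notin> P" by (rule prime_ideal_one_notin)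
    ultimately show ?thesis
      using that(2) by (auto intro: loc_contraction_extensionI[where u = 1])
  qed
  then show ?thesis by (auto simp: symbolic_power_def)
qed

text \<open>A term of least degree of \<open>p\<close> outside the ideal survives in \<open>u * p\<close>.\<close>

lemma monomial_ideal_saturated:
  fixes u p :: "('v::finite, 'k::field) mpoly"
  assumes "lookup u 0 \<noteq> 0" and "u * p \<in> monomial_ideal S"
  shows "p \<in> monomial_ideal S"
proof (rule ccontr)
  define deg :: "('v \<Rightarrow>\<^sub>0 nat) \<Rightarrow> nat" where "deg m = (\<Sum>v\<in>UNIV. lookup m v)" for m
  let ?bad = "\<lambda>m. m \<in> keys p \<and> \<not> (\<exists>g\<in>S. mon_dvd g m)"
  assume "p \<notin> monomial_ideal S"
  then obtain m where "?bad m" by (auto simp: monomial_ideal_def)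
  then obtain m where m: "?bad m" and min: "\<And>m'. ?bad m' \<Longrightarrow> deg m \<le> deg m'"
    using arg_min_nat_lemma[of ?bad _ deg] by blast
  have "lookup (u * p) (0 + m) = lookup u 0 * lookup p m"
  proof (rule lookup_mult_unique_factorization)
    fix l k assume "l \<in> keys u" "k \<in> keys p" "l + k = 0 + m"
    then have eq: "m = l + k" by simp
    \<comment> \<open>As \<open>k\<close> divides \<open>m\<close>, a generator dividing
      \<open>k\<close> would divide \<open>m\<close>. So \<open>k\<close> is bad too, and minimality
      leaves degree 0 for \<open>l\<close>.\<close>
    have "\<not> (\<exists>g\<in>S. mon_dvd g k)"
      using m unfolding eq lookup_add by (metis trans_le_add2)
    then have "deg m \<le> deg k" using min \<open>k \<in> keys p\<close> by blast
    then have "deg l = 0" by (simp add: eq deg_def lookup_add sum.distrib)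
    then show "l = 0" by (intro poly_mapping_eqI) (simp add: deg_def)
  qed
  then have "m \<in> keys (u * p)"
    using assms(1) m by (simp add: in_keys_iff)
  with m assms(2) show False unfolding monomial_ideal_def by blast
qed


text \<open>Multiplication by a monomial shifts the support injectively, so no terms cancel.\<close>

lemma monom_mult_mem_monomial_ideal_iff:
  fixes p :: "('v, 'k::field) mpoly"
  shows "monom d * p \<in> monomial_ideal S \<longleftrightarrow> (\<forall>k\<in>keys p. \<exists>g\<in>S. mon_dvd g (d + k))" (is "?L \<longleftrightarrow> ?R")
proof
  show ?R if ?L
  proof
    fix k assume "k \<in> keys p"
    then have "d + k \<in> keys (monom d * p)"
      by (simp add: in_keys_iff lookup_monom_mult)
    with that show "\<exists>g\<in>S. mon_dvd g (d + k)" by (auto simp: monomial_ideal_def)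
  qed
  show ?L if ?R
    using that keys_mult[of "monom d" p] by (force simp: monomial_ideal_def)
qed

section \<open>If the whole vertex set is a strong vertex cover\<close>

lemma strong_vertex_cover_UNIV_iff:
  "strong_vertex_cover E w UNIV \<longleftrightarrow> (\<forall>x. \<exists>y. (y, x) \<in> E \<and> w y \<noteq> 1)"
proof -
  have "L1 E UNIV = {}" "L2 E UNIV = {}" "L3 E UNIV = UNIV"
    by (auto simp: L1_def L2_def L3_def)
  then show ?thesis
    by (auto simp: strong_vertex_cover_def vertex_cover_def heavy_vertices_def)
qed

lemma prime_ideal_constant_coeff_0: "prime_ideal {r :: ('v, 'k::field) mpoly. lookup r 0 = 0}"
proof -
  have "ideal.subspace {r :: ('v, 'k) mpoly. lookup r 0 = 0}"
    by (rule ideal.subspaceI) (simp_all add: lookup_add lookup_mult_0)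
  moreover have "{r :: ('v, 'k) mpoly. lookup r 0 = 0} \<noteq> UNIV"
  proof
    assume "{r :: ('v, 'k) mpoly. lookup r 0 = 0} = UNIV"
    then have "lookup (1 :: ('v, 'k) mpoly) 0 = 0" by blast
    then show False by simp
  qed
  ultimately show ?thesis
    unfolding prime_ideal_def by (simp add: lookup_mult_0)
qed

text \<open>The irrelevant ideal is the annihilator of the class of \<open>\<Prod>v. v ^ (w v - 1)\<close>.\<close>

lemma constant_coeff_0_associated:
  fixes E :: "('v::finite \<times> 'v) set"
  assumes G: "weighted_oriented_graph E w" and strong: "\<forall>x. \<exists>y. (y, x) \<in> E \<and> w y \<noteq> 1"
  shows "{r :: ('v, 'k::field) mpoly. lookup r 0 = 0} \<in> associated_primes (edge_ideal E w)"
proof -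
  define d where "d = (\<Sum>v\<in>UNIV. Poly_Mapping.single v (w v - 1))"
  have d: "lookup d v = w v - 1" for v
    by (simp add: d_def lookup_sum lookup_single when_def)
  have pos: "w v \<ge> 1" for v
    using G by (simp add: weighted_oriented_graph_def)
  have "lookup r 0 = 0 \<longleftrightarrow> r * monom d \<in> edge_ideal E w" for r :: "('v, 'k) mpoly"
  proof
    assume r: "lookup r 0 = 0"
    have "\<exists>g\<in>edge_exp w ` E. mon_dvd g (d + k)" if "k \<in> keys r" for k
    proof -
      have "k \<noteq> 0" using r that by auto
      then obtain x where x: "lookup k x \<noteq> 0"
        by (metis lookup_zero poly_mapping_eqI)
      obtain y where y: "(y, x) \<in> E" "w y \<noteq> 1" using strong by blast
      have "x \<noteq> y" using y G by (auto simp: weighted_oriented_graph_def)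
      \<comment> \<open>The factor \<open>x\<close> in \<open>k\<close> lifts the exponent of
        \<open>x\<close> to at least \<open>w x\<close>, and \<open>w y\<close> being at least 2
        leaves \<open>y\<close> a positive exponent in \<open>d\<close>.\<close>
      have "lookup (edge_exp w (y, x)) v \<le> lookup (d + k) v" for v
        using x y(2) pos[of y] pos[of x] \<open>x \<noteq> y\<close>
        by (auto simp: lookup_edge_exp lookup_add d)
      with y(1) show ?thesis by blast
    qed
    then show "r * monom d \<in> edge_ideal E w"
      by (simp add: edge_ideal_eq mult.commute[of r] monom_mult_mem_monomial_ideal_iff)
  next
    assume "r * monom d \<in> edge_ideal E w"
    then have *: "\<forall>k\<in>keys r. \<exists>g\<in>edge_exp w ` E. mon_dvd g (d + k)"
      by (simp add: edge_ideal_eq mult.commute[of r] monom_mult_mem_monomial_ideal_iff)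
    show "lookup r 0 = 0"
    proof (rule ccontr)
      assume "lookup r 0 \<noteq> 0"
      then have "0 \<in> keys r" by (simp add: in_keys_iff)
      with * obtain x y where "(x, y) \<in> E" and dvd: "mon_dvd (edge_exp w (x, y)) d"
        by force
      \<comment> \<open>Every edge fails at its head, where \<open>d\<close> is one short of the
        weight.\<close>
      from dvd have "lookup (edge_exp w (x, y)) y \<le> lookup d y" by blast
      then show False using pos[of y] by (auto simp: lookup_edge_exp d split: if_splits)
    qed
  qed
  then show ?thesis
    using prime_ideal_constant_coeff_0 unfolding associated_primes_def by blast
qed

text \<open>One component of the intersection suffices: a denominator outside the irrelevant ideal
  has nonzero constant coefficient and is cancelled by
  \<open>monomial_ideal_saturated\<close>.\<close>

lemma symbolic_power_eq_if_strong:
  fixes E :: "('v::finite \<times> 'v) set"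
  assumes "weighted_oriented_graph E w" and "\<forall>x. \<exists>y. (y, x) \<in> E \<and> w y \<noteq> 1"
  shows "symbolic_power (edge_ideal E w :: ('v, 'k::field) mpoly set) s
    = ideal_power (edge_ideal E w) s"
proof
  let ?M = "{r :: ('v, 'k) mpoly. lookup r 0 = 0}"
  let ?J = "ideal_power (edge_ideal E w) s :: ('v, 'k) mpoly set"
  show "symbolic_power (edge_ideal E w) s \<subseteq> ?J"
  proof
    fix r :: "('v, 'k) mpoly" assume "r \<in> symbolic_power (edge_ideal E w) s"
    then have "r \<in> loc_contraction ?M (loc_extension ?M ?J)"
      using constant_coeff_0_associated[OF assms] unfolding symbolic_power_def by blast
    moreover have "ideal.subspace ?J"
      by (simp add: ideal_power_edge_ideal subspace_monomial_ideal)
    ultimately obtain u where "u \<notin> ?M" "u * r \<in> ?J"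
      using loc_contraction_extensionD[OF prime_ideal_constant_coeff_0] by blast
    then show "r \<in> ?J"
      by (auto simp: ideal_power_edge_ideal intro: monomial_ideal_saturated)
  qed
qed (rule ideal_power_subset_symbolic_power)

section \<open>Membership in localized powers\<close>

text \<open>For a prime \<open>P\<close> and an ideal \<open>J\<close> this says that
  \<open>q/1\<close> lies in the extension of \<open>J\<close>, with the denominator explicit to
  avoid calculating with fraction classes.\<close>

definition locally_in :: "'a::comm_ring_1 set \<Rightarrow> 'a set \<Rightarrow> 'a \<Rightarrow> bool" where
  "locally_in P J q \<longleftrightarrow> (\<exists>u. u \<notin> P \<and> u * q \<in> J)"

lemma locally_in_mult:
  assumes "prime_ideal P" "locally_in P I q" "locally_in P (ideal_power I j) q'"
  shows "locally_in P (ideal_power I (Suc j)) (q * q')"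
proof -
  obtain u u' where u: "u \<notin> P" "u * q \<in> I" "u' \<notin> P" "u' * q' \<in> ideal_power I j"
    using assms(2,3) by (auto simp: locally_in_def)
  have "(u * q) * (u' * q') \<in> ideal_power I (Suc j)"
    unfolding ideal_power.simps ideal_mult_def using u by (intro ideal.span_base) blast
  moreover have "(u * q) * (u' * q') = (u * u') * (q * q')" by (simp add: algebra_simps)
  moreover have "u * u' \<notin> P" using assms(1) u(1,3) by (rule prime_ideal_mult_notin)
  ultimately show ?thesis unfolding locally_in_def by metis
qed

lemma locally_in_scale:
  assumes "ideal.subspace J" "locally_in P J q"
  shows "locally_in P J (r * q)"
proof -
  obtain u where u: "u \<notin> P" "u * q \<in> J" using assms(2) by (auto simp: locally_in_def)
  have "u * (r * q) = r * (u * q)" by (simp add: algebra_simps)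
  then show ?thesis
    using u ideal.subspace_scale[OF assms(1) u(2), of r] unfolding locally_in_def by metis
qed

text \<open>Each pair of consecutive factors supplies one power of \<open>I\<close>. The offset
  \<open>k\<close> allows paths that start after the first vertices of an enumeration.\<close>

lemma locally_in_prod_pairs:
  fixes g :: "nat \<Rightarrow> 'a::comm_ring_1"
  assumes "prime_ideal P"
    and "\<And>i. i < n \<Longrightarrow> locally_in P I (g (k + 2 * i) * g (Suc (k + 2 * i)))"
  shows "locally_in P (ideal_power I n) (\<Prod>j<2 * n. g (k + j))"
  using assms(2)
proof (induction n)
  case 0
  show ?case using prime_ideal_one_notin[OF assms(1)] by (auto simp: locally_in_def)
next
  case (Suc n)
  have "locally_in P (ideal_power I (Suc n))
      ((g (k + 2 * n) * g (Suc (k + 2 * n))) * (\<Prod>j<2 * n. g (k + j)))"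
    using Suc by (intro locally_in_mult assms(1)) auto
  moreover have "(g (k + 2 * n) * g (Suc (k + 2 * n))) * (\<Prod>j<2 * n. g (k + j))
      = (\<Prod>j<2 * Suc n. g (k + j))"
    by (simp add: mult_ac)
  ultimately show ?case by metis
qed

lemma subspace_edge_ideal: "ideal.subspace (edge_ideal E w)"
  by (simp add: edge_ideal_def)

lemma edge_product_mem:
  fixes a b :: nat
  assumes "(x, y) \<in> E" "a \<ge> 1" "b \<ge> w y"
  shows "Var x ^ a * Var y ^ b \<in> (edge_ideal E w :: ('v, 'k::field) mpoly set)"
proof -
  have "Var x * Var y ^ w y \<in> (edge_ideal E w :: ('v, 'k) mpoly set)"
    unfolding edge_ideal_def using assms(1) by (intro ideal.span_base) auto
  then have "(Var x ^ (a - 1) * Var y ^ (b - w y)) * (Var x * Var y ^ w y)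
      \<in> (edge_ideal E w :: ('v, 'k) mpoly set)"
    by (rule ideal.subspace_scale[OF subspace_edge_ideal])
  moreover have "(Var x ^ (a - 1) * Var y ^ (b - w y)) * (Var x * Var y ^ w y)
      = (Var x ^ a * Var y ^ b :: ('v, 'k) mpoly)"
  proof -
    have "Var x ^ (a - 1) * Var x = (Var x ^ a :: ('v, 'k) mpoly)"
      using assms(2) by (intro power_minus_mult) simp
    moreover have "Var y ^ (b - w y) * Var y ^ w y = (Var y ^ b :: ('v, 'k) mpoly)"
      using assms(3) by (simp flip: power_add)
    moreover have "(Var x ^ (a - 1) * Var y ^ (b - w y)) * (Var x * Var y ^ w y)
        = (Var x ^ (a - 1) * Var x) * (Var y ^ (b - w y) * Var y ^ w y :: ('v, 'k) mpoly)"
      by (simp only: mult_ac)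
    ultimately show ?thesis by simp
  qed
  ultimately show ?thesis by metis
qed

abbreviation adjacent :: "('v \<times> 'v) set \<Rightarrow> 'v \<Rightarrow> 'v \<Rightarrow> bool" where
  "adjacent E x y \<equiv> (x, y) \<in> E \<or> (y, x) \<in> E"

text \<open>The variable \<open>z\<close> is a unit locally at \<open>P\<close>, so the edge
  generator reduces to a power of \<open>v\<close>; its exponent exceeds 1 only if \<open>v\<close>
  is the head.\<close>

lemma locally_in_edge_ideal_if_nbr:
  fixes P :: "('v, 'k::field) mpoly set" and a :: nat
  assumes "prime_ideal P" "Var z \<notin> P" "adjacent E v z" "a \<ge> 1" "(z, v) \<in> E \<Longrightarrow> a \<ge> w v"
  shows "locally_in P (edge_ideal E w) (Var v ^ a)"
  using assms(3)
proof
  assume "(v, z) \<in> E"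
  then have "Var z ^ w z * Var v ^ a \<in> (edge_ideal E w :: ('v, 'k) mpoly set)"
    using edge_product_mem[of v z E a w "w z"] assms(4) by (simp add: mult.commute)
  then show ?thesis
    using prime_ideal_power_notin[OF assms(1,2)] unfolding locally_in_def by blast
next
  assume "(z, v) \<in> E"
  then have "Var z * Var v ^ a \<in> (edge_ideal E w :: ('v, 'k) mpoly set)"
    using edge_product_mem[of z v E 1 w a] assms(5) by simp
  then show ?thesis
    using assms(2) unfolding locally_in_def by blast
qed

text \<open>If \<open>P\<close> is the annihilator of \<open>f\<close>, take a term \<open>h\<close> of \<open>f\<close> outside the edge ideal: for each
  variable \<open>v\<close> in \<open>P\<close> some generator divides \<open>v h\<close> but not \<open>h\<close>, which pins down the exponent of \<open>v\<close>
  in \<open>h\<close>. Applied to \<open>x\<close> and then to the other end of the edge found, this is contradictory if all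
  neighbours of \<open>x\<close> lie in \<open>P\<close>.\<close>

lemma ex_nbr_notin_associated_prime:
  fixes E :: "('v::finite \<times> 'v) set" and P :: "('v, 'k::field) mpoly set"
  assumes G: "weighted_oriented_graph E w" and light: "\<And>y. (y, x) \<in> E \<Longrightarrow> w y = 1"
    and P: "P \<in> associated_primes (edge_ideal E w)" and "Var x \<in> P"
  shows "\<exists>z. adjacent E x z \<and> Var z \<notin> P"
proof (rule ccontr)
  assume "\<not> ?thesis"
  then have nbrs: "Var z \<in> P" if "adjacent E x z" for z
    using that by blast
  obtain f where f: "P = {r. r * f \<in> edge_ideal E w}" and "prime_ideal P"
    using P by (auto simp: associated_primes_def)
  then have "1 \<notin> P" by (intro prime_ideal_one_notin)
  then have "f \<notin> edge_ideal E w" by (simp add: f)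
  then obtain h where h: "h \<in> keys f" "\<And>e. e \<in> E \<Longrightarrow> \<not> mon_dvd (edge_exp w e) h"
    by (auto simp: edge_ideal_eq monomial_ideal_def)
  have pos: "w v \<ge> 1" for v
    using G by (simp add: weighted_oriented_graph_def)
  have irrefl: "(v, v) \<notin> E" for v
    using G by (simp add: weighted_oriented_graph_def)
  have key: "(\<exists>y. (v, y) \<in> E \<and> lookup h v = 0 \<and> w y \<le> lookup h y)
      \<or> (\<exists>y. (y, v) \<in> E \<and> lookup h v = w v - 1 \<and> 1 \<le> lookup h y)" if "Var v \<in> P" for v
  proof -
    have "monom (Poly_Mapping.single v 1) * f \<in> monomial_ideal (edge_exp w ` E)"
      using that by (simp add: f edge_ideal_eq Var_def)
    then obtain a b where ab: "(a, b) \<in> E"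
      and dvd: "mon_dvd (edge_exp w (a, b)) (Poly_Mapping.single v 1 + h)"
      using h(1) unfolding monom_mult_mem_monomial_ideal_iff by force
    have ndvd: "\<not> mon_dvd (edge_exp w (a, b)) h" using h(2) ab by blast
    have neq: "a \<noteq> b" using ab irrefl by auto
    from dvd have le: "(if u = a then 1 else 0) + (if u = b then w b else 0)
        \<le> (if u = v then 1 else 0) + lookup h u" for u
      by (auto simp: lookup_edge_exp lookup_add lookup_single when_def dest!: spec[of _ u] split: if_splits)
    have lea: "1 \<le> (if a = v then 1 else 0) + lookup h a" using le[of a] neq by simp
    have leb: "w b \<le> (if b = v then 1 else 0) + lookup h b" using le[of b] neq by simp
    have "\<not> (1 \<le> lookup h a \<and> w b \<le> lookup h b)"
      using ndvd neq by (auto simp: lookup_edge_exp split: if_splits)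
    \<comment> \<open>Only the exponent of \<open>v\<close> was raised, so \<open>v\<close> is the
      end of the edge at which \<open>h\<close> falls exactly one short.\<close>
    then consider "a = v" "lookup h a = 0" | "b = v" "lookup h b = w b - 1" "b \<noteq> a"
      using lea leb pos[of b] neq by (auto split: if_splits)
    then show ?thesis
    proof cases
      case 1
      then show ?thesis using ab leb neq by auto
    next
      case 2
      then show ?thesis using ab lea by auto
    qed
  qed
  \<comment> \<open>By \<open>key\<close>, the exponent of \<open>y\<close> in \<open>h\<close> is 0
    or \<open>w y - 1\<close>. The first case requires at least \<open>w y\<close>; the second
    requires at least 1, while \<open>w y = 1\<close> makes both values 0.\<close>
  from key[OF \<open>Var x \<in> P\<close>] show False
  proof (elim disjE exE conjE)
    fix y assume y: "(x, y) \<in> E" "w y \<le> lookup h y"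
    then show False using key[of y] nbrs[of y] pos[of y] by auto
  next
    fix y assume y: "(y, x) \<in> E" "1 \<le> lookup h y"
    then show False using key[of y] nbrs[of y] light[of y] by auto
  qed
qed

section \<open>Odd cycles\<close>

text \<open>The cycle is rotated to start at \<open>x\<close>. The last property keeps what
  inducedness gives: \<open>x\<close> has no neighbours in \<open>W\<close> beyond the two on the
  cycle.\<close>

lemma induced_odd_cycle_enumeration:
  assumes "induced_odd_cycle E W" "x \<in> W"
  obtains p n where "n \<ge> 1" "p 0 = x" "bij_betw p {..<Suc (2 * n)} W"
    "\<forall>i<2 * n. adjacent E (p i) (p (Suc i))" "adjacent E (p (2 * n)) (p 0)"
    "\<forall>y\<in>W. adjacent E x y \<longrightarrow> y = p 1 \<or> y = p (2 * n)"
proof -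
  let ?G = "underlying_edges (induced_edges E W)"
  obtain c where c: "length c \<ge> 3" "distinct c" "set c = W"
    and G: "?G = {{c ! i, c ! (Suc i mod length c)} | i. i < length c}"
    and odd: "odd (card W)"
    using assms(1) by (auto simp: induced_odd_cycle_def is_cycle_graph_def)
  have adj_iff: "{a, b} \<in> ?G \<longleftrightarrow> adjacent E a b \<and> a \<in> W \<and> b \<in> W" for a b
    by (auto simp: underlying_edges_def induced_edges_def doubleton_eq_iff)
  define N where "N = length c"
  have "card W = N" using c distinct_card[of c] by (simp add: N_def)
  with odd obtain n where n: "N = Suc (2 * n)" by (auto elim: oddE)
  obtain k where k: "k < N" "c ! k = x"
    using assms(2) c(3) by (auto simp: in_set_conv_nth N_def)
  define p where "p = (!) (rotate k c)"
  have p: "p i = c ! ((k + i) mod N)" if "i < N" for i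
    using that by (simp add: p_def N_def nth_rotate add.commute)
  have edge: "adjacent E (p i) (p (Suc i mod N))" if "i < N" for i
  proof -
    let ?j = "(k + i) mod N"
    have "?j < N" using n by simp
    then have "{c ! ?j, c ! (Suc ?j mod N)} \<in> ?G" unfolding G N_def by blast
    moreover have "Suc ?j mod N = (k + Suc i mod N) mod N"
      by (simp add: mod_simps)
    ultimately show ?thesis
      using that n by (simp add: p adj_iff)
  qed
  show thesis
  proof
    show "n \<ge> 1" using c(1) n by (simp add: N_def)
    show "p 0 = x" using k n by (simp add: p)
    show "bij_betw p {..<Suc (2 * n)} W"
      unfolding p_def using c n by (intro bij_betw_nth) (auto simp: N_def)
    show "\<forall>i<2 * n. adjacent E (p i) (p (Suc i))"
      using edge n by (metis less_SucI mod_less Suc_less_eq)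
    show "adjacent E (p (2 * n)) (p 0)"
      using edge[of "2 * n"] n by simp
    show "\<forall>y\<in>W. adjacent E x y \<longrightarrow> y = p 1 \<or> y = p (2 * n)"
    proof (intro ballI impI)
      fix y assume "y \<in> W" "adjacent E x y"
      then have "{x, y} \<in> ?G" using assms(2) adj_iff by blast
      then obtain j where j: "j < N" "{x, y} = {c ! j, c ! (Suc j mod N)}"
        unfolding G N_def by blast
      then consider "x = c ! j" "y = c ! (Suc j mod N)" | "x = c ! (Suc j mod N)" "y = c ! j"
        by (auto simp: doubleton_eq_iff)
      then show "y = p 1 \<or> y = p (2 * n)"
      proof cases
        case 1
        then have "j = k" using j(1) k c(2) by (auto simp: nth_eq_iff_index_eq N_def)
        with 1 show "y = p 1 \<or> y = p (2 * n)" using p[of 1] c(1) by (simp add: N_def)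
      next
        case 2
        have "c ! (Suc j mod N) = c ! k" using 2(1) k(2) by simp
        moreover have "Suc j mod N < length c" using n by (simp flip: N_def)
        ultimately have "Suc j mod N = k"
          using k(1) c(2) by (simp add: nth_eq_iff_index_eq N_def)
        \<comment> \<open>Adding \<open>2 * n = N - 1\<close> undoes a successor modulo
          \<open>N\<close>, so \<open>y\<close> is the last vertex of the enumeration.\<close>
        then have "(k + 2 * n) mod N = (Suc j + 2 * n) mod N"
          by (metis mod_add_left_eq)
        also have "\<dots> = (j + N) mod N" using n by simp
        also have "\<dots> = j" using j(1) by simp
        finally show "y = p 1 \<or> y = p (2 * n)" using 2 p[of "2 * n"] n by simp
      qed
    qed
  qed
qed

text \<open>A vertex without incoming edges inside \<open>W\<close> only gets exponent \<open>1\<close>; otherwise the two edges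
  leaving it could be used simultaneously.\<close>

definition cycle_exp :: "('v \<times> 'v) set \<Rightarrow> ('v \<Rightarrow> nat) \<Rightarrow> 'v set \<Rightarrow> 'v \<Rightarrow> nat" where
  "cycle_exp E w W v = (if \<exists>u\<in>W. (u, v) \<in> E then w v else 1)"

lemma cycle_exp_pos: "weighted_oriented_graph E w \<Longrightarrow> cycle_exp E w W v \<ge> 1"
  by (simp add: cycle_exp_def weighted_oriented_graph_def)

section \<open>The odd-cycle monomial in symbolic and ordinary powers\<close>

lemma cycle_monomial_mem_symbolic_power:
  fixes E :: "('v::finite \<times> 'v) set"
  assumes G: "weighted_oriented_graph E w" and W: "induced_odd_cycle E W" "x \<in> W"
    and light: "\<And>y. (y, x) \<in> E \<Longrightarrow> w y = 1" and x: "cycle_exp E w W x = w x"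
    and card: "card W = Suc (2 * n)"
  shows "(\<Prod>v\<in>W. Var v ^ cycle_exp E w W v)
    \<in> symbolic_power (edge_ideal E w :: ('v, 'k::field) mpoly set) (Suc n)"
  unfolding symbolic_power_def
proof
  let ?I = "edge_ideal E w :: ('v, 'k) mpoly set"
  let ?t = "\<lambda>v. Var v ^ cycle_exp E w W v :: ('v, 'k) mpoly"
  fix P assume PA: "P \<in> associated_primes ?I"
  then have P: "prime_ideal P" by (simp add: associated_primes_def)
  then have one: "1 \<notin> P" by (rule prime_ideal_one_notin)
  have sub: "ideal.subspace (ideal_power ?I j)" for j
    by (simp add: ideal_power_edge_ideal subspace_monomial_ideal)
  \<comment> \<open>Since \<open>z\<close> lies in \<open>W\<close>, an edge from \<open>z\<close>
    to \<open>v\<close> gives \<open>v\<close> its full weight as exponent.\<close>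
  have single: "locally_in P ?I (?t v)" if "v \<in> W" "z \<in> W" "adjacent E v z" "Var z \<notin> P" for v z
    using that P cycle_exp_pos[OF G]
    by (intro locally_in_edge_ideal_if_nbr) (auto simp: cycle_exp_def)
  have pair: "locally_in P ?I (?t v * ?t z)" if "v \<in> W" "z \<in> W" "adjacent E v z" for v z
  proof -
    have "?t v * ?t z \<in> ?I" if "(v, z) \<in> E" "v \<in> W" for v z
      using that cycle_exp_pos[OF G] by (intro edge_product_mem) (auto simp: cycle_exp_def)
    then have "?t v * ?t z \<in> ?I"
      using that by (metis mult.commute)
    then show ?thesis
      using one unfolding locally_in_def by (metis mult_1)
  qed
  have "locally_in P (ideal_power ?I (Suc n)) (\<Prod>v\<in>W. ?t v)"
  proof (cases "\<forall>v\<in>W. Var v \<in> P")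
    case True
    obtain p m where p: "p 0 = x" "bij_betw p {..<Suc (2 * m)} W"
      "\<forall>i<2 * m. adjacent E (p i) (p (Suc i))"
      by (rule induced_odd_cycle_enumeration[OF W])
    have mn: "m = n" using bij_betw_same_card[OF p(2)] card by simp
    have pW: "p i \<in> W" if "i \<le> 2 * n" for i
      using bij_betwE[OF p(2)] that mn by auto
    obtain z where z: "adjacent E x z" "Var z \<notin> P"
      using ex_nbr_notin_associated_prime[OF G light PA] True W(2) by blast
    \<comment> \<open>Here \<open>z\<close> lies outside \<open>W\<close>, as all of
      \<open>W\<close> is in \<open>P\<close>. If the edge points at \<open>x\<close>, the exponent
      must reach \<open>w x\<close>, which the assumption on \<open>cycle_exp\<close> at
      \<open>x\<close> ensures.\<close>
    have "locally_in P ?I (?t x)"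
      using P z cycle_exp_pos[OF G, of W x] x by (intro locally_in_edge_ideal_if_nbr) auto
    moreover have "locally_in P (ideal_power ?I n) (\<Prod>j<2 * n. ?t (p (1 + j)))"
      using P
    proof (rule locally_in_prod_pairs[where g = "\<lambda>j. ?t (p j)"])
      fix i assume "i < n"
      then show "locally_in P ?I (?t (p (1 + 2 * i)) * ?t (p (Suc (1 + 2 * i))))"
        using p(3)[rule_format, of "1 + 2 * i"] mn by (intro pair pW) auto
    qed
    ultimately have "locally_in P (ideal_power ?I (Suc n)) (?t x * (\<Prod>j<2 * n. ?t (p (1 + j))))"
      using P by (intro locally_in_mult)
    also have "?t x * (\<Prod>j<2 * n. ?t (p (1 + j))) = (\<Prod>j<Suc (2 * n). ?t (p j))"
      unfolding prod.lessThan_Suc_shift by (simp add: p(1))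
    also have "\<dots> = (\<Prod>v\<in>W. ?t v)"
      using prod.reindex_bij_betw[OF p(2), of ?t] mn by simp
    finally show ?thesis .
  next
    case False
    then obtain v where v: "v \<in> W" "Var v \<notin> P" by blast
    obtain p m where m: "m \<ge> 1" and p: "p 0 = v" "bij_betw p {..<Suc (2 * m)} W"
      "\<forall>i<2 * m. adjacent E (p i) (p (Suc i))" "adjacent E (p (2 * m)) (p 0)"
      by (rule induced_odd_cycle_enumeration[OF W(1) v(1)])
    have mn: "m = n" using bij_betw_same_card[OF p(2)] card by simp
    then obtain k where k: "n = Suc k" using m by (cases n) auto
    have pW: "p i \<in> W" if "i \<le> 2 * n" for i
      using bij_betwE[OF p(2)] that mn by auto
    \<comment> \<open>Positions 1 and \<open>2 * n\<close> are the neighbours of \<open>v\<close>;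
      positions 2 to \<open>2 * n - 1\<close> pair off into \<open>k = n - 1\<close> edges.\<close>
    have mid: "locally_in P (ideal_power ?I k) (\<Prod>j<2 * k. ?t (p (2 + j)))"
      using P
    proof (rule locally_in_prod_pairs[where g = "\<lambda>j. ?t (p j)"])
      fix i assume "i < k"
      then show "locally_in P ?I (?t (p (2 + 2 * i)) * ?t (p (Suc (2 + 2 * i))))"
        using p(3)[rule_format, of "2 + 2 * i"] mn k by (intro pair pW) auto
    qed
    have first: "locally_in P ?I (?t (p 1))"
      using p(1) p(3)[rule_format, of 0] v pW[of 1] mn k by (intro single[of _ v]) auto
    have last: "locally_in P ?I (?t (p (2 * n)))"
      using p(1,4) v pW[of "2 * n"] mn by (intro single[of _ v]) auto
    \<comment> \<open>Two neighbours and \<open>k\<close> edges give \<open>k + 2 = n + 1\<close>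
      factors; the factor of \<open>v\<close> is only carried along.\<close>
    have "locally_in P (ideal_power ?I (Suc n))
        (?t v * (?t (p (2 * n)) * (?t (p 1) * (\<Prod>j<2 * k. ?t (p (2 + j))))))"
      unfolding k using first last mid
      by (intro locally_in_scale sub locally_in_mult P) (simp_all add: k)
    also have "?t v * (?t (p (2 * n)) * (?t (p 1) * (\<Prod>j<2 * k. ?t (p (2 + j)))))
        = (\<Prod>j<Suc (Suc (Suc (2 * k))). ?t (p j))"
      by (subst prod.lessThan_Suc, subst prod.lessThan_Suc_shift, subst prod.lessThan_Suc_shift)
        (simp add: p(1) k mult_ac)
    also have "\<dots> = (\<Prod>v\<in>W. ?t v)"
      using prod.reindex_bij_betw[OF p(2), of ?t] mn k by simp
    finally show ?thesis .
  qed
  then show "(\<Prod>v\<in>W. ?t v) \<in> loc_contraction P (loc_extension P (ideal_power ?I (Suc n)))"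
    using P by (auto simp: locally_in_def intro: loc_contraction_extensionI)
qed

text \<open>A shared vertex that is a head of one edge would need more than its weight. A shared
  tail needs exponent 2, hence has an in-neighbour in \<open>W\<close>, which together with the two
  heads makes three neighbours on the cycle.\<close>

lemma disjoint_edges_if_dvd_cycle_monomial:
  assumes G: "weighted_oriented_graph E w" and W: "induced_odd_cycle E W"
    and E: "(t, h) \<in> E" "(t', h') \<in> E"
    and dvd: "\<And>v. lookup (edge_exp w (t, h) + edge_exp w (t', h')) v
      \<le> (if v \<in> W then cycle_exp E w W v else 0)"
  shows "{t, h} \<inter> {t', h'} = {}"
proof -
  have pos: "w v \<ge> 1" and irrefl: "(v, v) \<notin> E" for v
    using G by (auto simp: weighted_oriented_graph_def)
  have asym: "(b, a) \<notin> E" if "(a, b) \<in> E" for a b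
    using G that by (auto simp: weighted_oriented_graph_def)
  have neq: "t \<noteq> h" "t' \<noteq> h'" using E irrefl by auto
  have le: "((if v = t then 1 else 0) + (if v = h then w h else 0))
      + ((if v = t' then 1 else 0) + (if v = h' then w h' else 0))
      \<le> (if v \<in> W then cycle_exp E w W v else 0)" for v
    using dvd[of v] by (simp only: lookup_add lookup_edge_exp)
  have inW: "t \<in> W" "h \<in> W" "t' \<in> W" "h' \<in> W"
    using le[of t] le[of h] le[of t'] le[of h'] pos[of h] pos[of h']
    by (auto split: if_splits)
  have ch: "cycle_exp E w W h = w h" "cycle_exp E w W h' = w h'"
    using E inW by (auto simp: cycle_exp_def)
  have "h \<noteq> h'" using le[of h] ch inW pos[of h] neq by auto
  moreover have "t \<noteq> h'" using le[of h'] ch inW neq by auto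
  moreover have "h \<noteq> t'" using le[of h] ch inW neq by auto
  moreover have "t \<noteq> t'"
  proof
    assume "t = t'"
    then have "2 \<le> cycle_exp E w W t" using le[of t] inW by (auto split: if_splits)
    then obtain u where u: "u \<in> W" "(u, t) \<in> E"
      by (auto simp: cycle_exp_def split: if_splits)
    obtain p :: "nat \<Rightarrow> 'a" and n
      where nbr: "\<forall>y\<in>W. adjacent E t y \<longrightarrow> y = p 1 \<or> y = p (2 * n)"
      by (rule induced_odd_cycle_enumeration[OF W inW(1)])
    have "u \<noteq> h" "u \<noteq> h'" using u E asym \<open>t = t'\<close> by blast+
    then show False
      using nbr u E inW \<open>t = t'\<close> \<open>h \<noteq> h'\<close> by metis
  qed
  ultimately show ?thesis by auto
qed

text \<open>A matching of \<open>n + 1\<close> edges needs \<open>2 * n + 2\<close> vertices, one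
  more than \<open>W\<close> has.\<close>

lemma cycle_monomial_notin_power:
  fixes E :: "('v::finite \<times> 'v) set"
  assumes G: "weighted_oriented_graph E w" and W: "induced_odd_cycle E W"
    and card: "card W = Suc (2 * n)"
  shows "(\<Prod>v\<in>W. Var v ^ cycle_exp E w W v)
    \<notin> ideal_power (edge_ideal E w :: ('v, 'k::field) mpoly set) (Suc n)"
proof
  let ?a = "\<lambda>v. if v \<in> W then cycle_exp E w W v else 0"
  define d where "d = (\<Sum>v\<in>W. Poly_Mapping.single v (cycle_exp E w W v))"
  have d: "lookup d v = ?a v" for v
    by (simp add: d_def lookup_sum lookup_single when_def)
  have "(\<Prod>v\<in>A. Var v ^ cycle_exp E w W v)
      = (monom (\<Sum>v\<in>A. Poly_Mapping.single v (cycle_exp E w W v)) :: ('v, 'k) mpoly)" for A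
    using finite[of A] by (induction A) (simp_all add: Var_power mult_single)
  then have *: "(\<Prod>v\<in>W. Var v ^ cycle_exp E w W v) = (monom d :: ('v, 'k) mpoly)"
    by (simp add: d_def)
  assume "(\<Prod>v\<in>W. Var v ^ cycle_exp E w W v)
    \<in> ideal_power (edge_ideal E w :: ('v, 'k::field) mpoly set) (Suc n)"
  then obtain es where es: "length es = Suc n" "set es \<subseteq> E"
    "\<And>v. lookup (sum_list (map (edge_exp w) es)) v \<le> ?a v"
    unfolding * ideal_power_edge_ideal monom_mem_monomial_ideal_iff d power_exps_def by blast
  \<comment> \<open>Distinctness of all tails and heads together says that the edges form a
    matching.\<close>
  have "distinct (map fst es @ map snd es) \<and> fst ` set es \<union> snd ` set es \<subseteq> W"
    using es(2,3)
  proof (induction es)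
    case (Cons e es)
    obtain t h where e: "e = (t, h)" by fastforce
    have th: "(t, h) \<in> E" using Cons.prems(1) e by simp
    have le: "lookup (edge_exp w e) v + lookup (sum_list (map (edge_exp w) es)) v \<le> ?a v" for v
      using Cons.prems(2)[of v] by (simp add: lookup_add)
    have IH: "distinct (map fst es @ map snd es) \<and> fst ` set es \<union> snd ` set es \<subseteq> W"
      using Cons.prems(1) add_leD2[OF le] by (intro Cons.IH) auto
    have pos: "w h \<ge> 1" using G by (simp add: weighted_oriented_graph_def)
    have "t \<in> W" "h \<in> W"
      using le[of t] le[of h] pos by (auto simp: e lookup_edge_exp split: if_splits)
    moreover have "t \<noteq> h" using th G by (auto simp: weighted_oriented_graph_def)
    moreover have "{t, h} \<inter> {fst e', snd e'} = {}" if e': "e' \<in> set es" for e'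
    proof -
      have "lookup (edge_exp w e') v \<le> lookup (sum_list (map (edge_exp w) es)) v" for v
        using e' by (induction es) (auto simp: lookup_add trans_le_add2)
      then have "lookup (edge_exp w (t, h) + edge_exp w (fst e', snd e')) v \<le> ?a v" for v
        using order_trans[OF add_left_mono le] by (simp only: lookup_add e prod.collapse)
      moreover have "(fst e', snd e') \<in> E" using e' Cons.prems(1) by auto
      ultimately show ?thesis
        using disjoint_edges_if_dvd_cycle_monomial[OF G W th] by blast
    qed
    ultimately show ?case using IH by (auto simp: e)
  qed simp
  then have "length (map fst es @ map snd es) \<le> card W"
    by (metis card_mono distinct_card finite image_Un set_append set_map)
  then show False using es(1) card by simp
qed

theorem theorem3p3:
  fixes E :: "('v::finite \<times> 'v) set" and w :: "'v \<Rightarrow> nat"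
  assumes "weighted_oriented_graph E w"
    and no_isolated: "\<forall>x. out_nbrs E x \<union> in_nbrs E x \<noteq> {}"
    and "\<forall>(x, y) \<in> E. \<exists>W. induced_odd_cycle E W \<and> x \<in> W \<and> y \<in> W"
  shows "strong_vertex_cover E w UNIV \<longleftrightarrow>
    (\<forall>s\<ge>2. symbolic_power (edge_ideal E w :: ('v, 'k::field) mpoly set) s
            = ideal_power (edge_ideal E w) s)"
proof
  assume "strong_vertex_cover E w UNIV"
  then show "\<forall>s\<ge>2. symbolic_power (edge_ideal E w :: ('v, 'k) mpoly set) s
      = ideal_power (edge_ideal E w) s"
    using symbolic_power_eq_if_strong[OF assms(1), where 'k = 'k] by (simp add: strong_vertex_cover_UNIV_iff)
next
  assume eq: "\<forall>s\<ge>2. symbolic_power (edge_ideal E w :: ('v, 'k) mpoly set) s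
      = ideal_power (edge_ideal E w) s"
  show "strong_vertex_cover E w UNIV"
  proof (rule ccontr)
    assume "\<not> strong_vertex_cover E w UNIV"
    then obtain x where light: "\<And>y. (y, x) \<in> E \<Longrightarrow> w y = 1"
      by (auto simp: strong_vertex_cover_UNIV_iff)
    \<comment> \<open>A source has weight 1 by convention, so any cycle through it works; otherwise
      the cycle is taken through an incoming edge.\<close>
    have "\<exists>W. induced_odd_cycle E W \<and> x \<in> W \<and> cycle_exp E w W x = w x"
    proof (cases "is_source E x")
      case True
      then obtain y where "(x, y) \<in> E"
        using no_isolated by (auto simp: is_source_def out_nbrs_def)
      then obtain W where "induced_odd_cycle E W" "x \<in> W" using assms(3) by blast
      moreover have "w x = 1" using True assms(1) by (simp add: weighted_oriented_graph_def)
      ultimately show ?thesis by (auto simp: cycle_exp_def)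
    next
      case False
      then obtain y where "(y, x) \<in> E" by (auto simp: is_source_def in_nbrs_def)
      moreover from this obtain W where "induced_odd_cycle E W" "x \<in> W" "y \<in> W"
        using assms(3) by blast
      ultimately show ?thesis by (auto simp: cycle_exp_def)
    qed
    then obtain W where W: "induced_odd_cycle E W" "x \<in> W" and x: "cycle_exp E w W x = w x"
      by blast
    obtain p :: "nat \<Rightarrow> 'v" and n where "n \<ge> 1" and p: "bij_betw p {..<Suc (2 * n)} W"
      by (rule induced_odd_cycle_enumeration[OF W])
    have card: "card W = Suc (2 * n)" using bij_betw_same_card[OF p] by simp
    \<comment> \<open>The cycle has at least three vertices, so the exponent \<open>Suc n\<close> is
      at least 2.\<close>
    have "symbolic_power (edge_ideal E w :: ('v, 'k) mpoly set) (Suc n)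
        = ideal_power (edge_ideal E w) (Suc n)"
      using eq \<open>n \<ge> 1\<close> by simp
    then show False
      using cycle_monomial_mem_symbolic_power[OF assms(1) W light x card, where 'k = 'k]
        cycle_monomial_notin_power[OF assms(1) W(1) card, where 'k = 'k] by simp
  qed
qed

end
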